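(* Every Riordan involution over $\mathbb{K}$ different from the identity $I=T(1\mid 1)$ and from $-I=T(-1\mid 1)$ is of the form $T(f\mid g)$, where, for some power series $\phi=\sum_{n\ge 0}\phi_nx^n\in\mathbb{K}[[x]]$ with $\phi_0\neq 0$, some odd power series $u=\sum_{k\ge 1}u_{2k-1}x^{2k-1}\in\mathbb{K}[[x]]$ and some choice of sign $\pm$, $$g=\frac{x}{\frac{x}{A}\left(-\frac{x}{\phi}\right)},\qquad f=\frac{\pm x}{\frac{x}{A}\left(-\frac{x}{\phi}\right)}\,e^{u\left(\frac{x}{\phi}\right)},$$ with $A\in\mathbb{K}[[x]]$ the power series such that $\frac{x}{A}$ is the compositional inverse of $\frac{x}{\phi}$.
   Context: $\mathbb{K}$ is a field of characteristic zero. Riordan matrices: for power series $f,g\in\mathbb{K}[[x]]$ with $f(0)\neq 0$ and $g(0)\neq 0$, the Riordan matrix $T(f\mid g)=(d_{n,k})_{n,k\ge 0}$ is the infinite lower triangular matrix whose $k$-th column ($k\ge 0$) has generating function $\sum_{n\ge 0} d_{n,k}x^n=\frac{x^k f(x)}{g(x)^{k+1}}$. These matrices form a group under matrix multiplication, the Riordan group, with product $T(f\mid g)\,T(l\mid m)=T\left(f\cdot l\left(\tfrac{x}{g}\right)\,\middle|\, g\cdot m\left(\tfrac{x}{g}\right)\right)$ and identity $I=T(1\mid 1)$. A Riordan involution is a Riordan matrix $T(f\mid g)$ with $T^2(f\mid g)=T(1\mid 1)=I$. For series, $\frac{x}{A}\left(-\frac{x}{\phi}\right)$ denotes the composition of the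 series $\frac{x}{A(x)}$ with the series $-\frac{x}{\phi(x)}$ (i.e. the latter is substituted for $x$ in the former), and $u\left(\frac{x}{\phi}\right)$ denotes the composition of $u$ with $\frac{x}{\phi(x)}$. The series $A$ is determined by $\phi$ through $\frac{x}{A}\left(\frac{x}{\phi}\right)=\frac{x}{\phi}\left(\frac{x}{A}\right)=x$, equivalently $T(1\mid A)=T^{-1}(1\mid\phi)$; it is called the $A$-sequence of $T(1\mid\phi)$. An odd power series has only odd-degree terms. The exponential $e^{v}$ of a power series $v$ with zero constant term is $\sum_{n\ge 0}v^n/n!$. *)

theory Defs
  imports Complex_Main "HOL-Computational_Algebra.Formal_Power_Series"
begin

definition riordan_matrix :: "'a::field fps \<Rightarrow> 'a fps \<Rightarrow> nat \<Rightarrow> nat \<Rightarrow> 'a" where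
  "riordan_matrix f g = (\<lambda>n k. fps_nth (fps_X ^ k * f / g ^ (k + 1)) n)"

definition is_riordan :: "(nat \<Rightarrow> nat \<Rightarrow> 'a::field) \<Rightarrow> bool" where
  "is_riordan M \<longleftrightarrow>
     (\<exists>f g. fps_nth f 0 \<noteq> 0 \<and> fps_nth g 0 \<noteq> 0 \<and> M = riordan_matrix f g)"

text \<open>Product of infinite lower triangular matrices: row \<open>n\<close> of the left factor is supported
  on the columns \<open>0, \<dots>, n\<close>, so the sum over all \<open>j\<close> stops at \<open>n\<close>.\<close>

definition lt_mult ::
  "(nat \<Rightarrow> nat \<Rightarrow> 'a::field) \<Rightarrow> (nat \<Rightarrow> nat \<Rightarrow> 'a) \<Rightarrow> nat \<Rightarrow> nat \<Rightarrow> 'a" where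
  "lt_mult M N = (\<lambda>n k. \<Sum>j\<le>n. M n j * N j k)"

lemma riordan_matrix_lower_triangular:
  assumes "fps_nth g 0 \<noteq> 0" and "n < k"
  shows "riordan_matrix f g n k = 0"
proof -
  have "fps_nth (g ^ (k + 1)) 0 \<noteq> 0"
    using assms(1) by (simp add: fps_nth_power_0)
  then have "fps_X ^ k * f / g ^ (k + 1) = fps_X ^ k * (f * inverse (g ^ (k + 1)))"
    by (simp add: fps_divide_unit mult.assoc)
  then show ?thesis
    using assms(2) by (simp only: riordan_matrix_def fps_X_power_mult_nth if_True)
qed

lemma riordan_matrix_1_1: "riordan_matrix 1 1 = (\<lambda>n k. if n = k then 1 else 0)"
  by (simp add: riordan_matrix_def fun_eq_iff fps_X_power_nth)

definition riordan_involution :: "(nat \<Rightarrow> nat \<Rightarrow> 'a::field) \<Rightarrow> bool" where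
  "riordan_involution M \<longleftrightarrow> is_riordan M \<and> lt_mult M M = riordan_matrix 1 1"

text \<open>\<open>A\<close> is the \<open>A\<close>-sequence of \<open>T(1 | \<phi>)\<close>: the series \<open>x/A\<close> is the two-sided compositional
  inverse of \<open>x/\<phi>\<close>. For \<open>\<phi>\<close> with nonzero constant term there is exactly one such \<open>A\<close>.\<close>

definition is_A_sequence :: "'a::field fps \<Rightarrow> 'a fps \<Rightarrow> bool" where
  "is_A_sequence \<phi> A \<longleftrightarrow> fps_nth A 0 \<noteq> 0 \<and>
     fps_compose (fps_X / A) (fps_X / \<phi>) = fps_X \<and>
     fps_compose (fps_X / \<phi>) (fps_X / A) = fps_X"

definition odd_fps :: "'a::zero fps \<Rightarrow> bool" where
  "odd_fps u \<longleftrightarrow> (\<forall>n. even n \<longrightarrow> fps_nth u n = 0)"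

text \<open>For \<open>v\<close> with zero constant term this is \<open>e\<^sup>v = (\<Sum>n. v\<^sup>n / n!)\<close>; \<open>fps_exp 1\<close> is the series
  \<open>e\<^sup>x\<close>.\<close>

definition fps_exp_of :: "'a::field_char_0 fps \<Rightarrow> 'a fps" where
  "fps_exp_of v = fps_compose (fps_exp 1) v"

end

theory Submission
  imports Defs
begin

text \<open>
  Write \<open>d = f/g\<close> and \<open>h = x/g\<close>, so that column \<open>k\<close> of \<open>T(f | g)\<close> is \<open>d h\<^sup>k\<close>. The matrix acts on
  generating functions by \<open>b \<mapsto> d \<sqdot> b(h)\<close>, and being an involution means exactly that
  \<open>d \<sqdot> d(h) = 1\<close> and \<open>h(h) = x\<close>.

  The second equation makes \<open>h'(0)\<close> a square root of \<open>1\<close>. If it is \<open>1\<close>, then \<open>h = x\<close> and \<open>d = \<plusminus>1\<close>,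
  which is the excluded case \<open>\<plusminus>I\<close>. If it is \<open>-1\<close>, averaging linearizes \<open>h\<close>: the series
  \<open>w = (x - h)/2\<close> has \<open>w(h) = -w\<close> and an invertible linear coefficient, so that
  \<open>h = v(-w)\<close> with \<open>v\<close> the compositional inverse of \<open>w\<close>. Take \<open>\<phi> = x/w\<close> and \<open>A = x/v\<close>.

  The first equation gives \<open>d(0) = \<plusminus>1\<close>; let \<open>d = \<plusminus>e\<^sup>L\<close>. Then \<open>d \<sqdot> d(h) = 1\<close> says \<open>L(h) = -L\<close>. In
  the coordinate \<open>w\<close>, where \<open>h\<close> is \<open>x \<mapsto> -x\<close>, this says that \<open>u = L(v)\<close> is odd, and \<open>L = u(w)\<close>.
\<close>

section \<open>Composition of power series\<close>

text \<open>Every series of order one has the form \<open>x/\<phi>\<close> in which the data of the theorem are expressed.\<close>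

lemma order_one_fps_eq_X_divide:
  fixes w :: "'a::field fps"
  assumes "fps_nth w 0 = 0" "fps_nth w 1 \<noteq> 0"
  obtains \<phi> where "fps_nth \<phi> 0 \<noteq> 0" "fps_X / \<phi> = w"
proof
  let ?p = "inverse (fps_shift 1 w)"
  show 0: "fps_nth ?p 0 \<noteq> 0" using assms by simp
  have "fps_X / ?p = fps_X * fps_shift 1 w"
    using 0 assms by (simp add: fps_divide_unit)
  also have "\<dots> = w"
    using assms by (intro fps_ext) simp
  finally show "fps_X / ?p = w" .
qed

lemma fps_compose_left_cancel:
  fixes a b c :: "'a::field fps"
  assumes "fps_nth a 0 = 0" "fps_nth a 1 \<noteq> 0" and "fps_nth b 0 = 0" "fps_nth c 0 = 0"
    and eq: "a oo b = a oo c"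
  shows "b = c"
proof -
  have "(fps_inv a oo a) oo b = (fps_inv a oo a) oo c"
    using assms by (simp flip: fps_compose_assoc)
  then show ?thesis using assms by (simp add: fps_inv)
qed

lemma odd_fps_iff_compose_uminus_X:
  fixes u :: "'a::field_char_0 fps"
  shows "odd_fps u \<longleftrightarrow> u oo - fps_X = - u"
proof -
  have "u oo - fps_X = Abs_fps (\<lambda>n. (-1) ^ n * fps_nth u n)"
    using fps_compose_linear[of u "-1"] by (simp flip: fps_const_neg)
  then have "u oo - fps_X = - u \<longleftrightarrow> (\<forall>n. (-1) ^ n * fps_nth u n = - fps_nth u n)"
    by (simp add: fps_eq_iff)
  also have "\<dots> \<longleftrightarrow> odd_fps u"
    unfolding odd_fps_def by (intro all_cong1) (auto simp: minus_one_power_iff)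
  finally show ?thesis by simp
qed

section \<open>Compositional involutions\<close>

text \<open>The sum \<open>x + h\<close> is invariant under \<open>h\<close> and, having linear coefficient \<open>2\<close>, can be cancelled.\<close>

lemma compose_involution_eq_X:
  fixes h :: "'a::field_char_0 fps"
  assumes "h oo h = fps_X" "fps_nth h 0 = 0" "fps_nth h 1 = 1"
  shows "h = fps_X"
proof (rule fps_compose_left_cancel)
  show "(fps_X + h) oo h = (fps_X + h) oo fps_X"
    using assms by (simp add: fps_compose_add_distrib add.commute)
qed (use assms in auto)

lemma compose_involution_linear_coeff:
  fixes h :: "'a::field fps"
  assumes "h oo h = fps_X" "fps_nth h 0 = 0"
  shows "fps_nth h 1 = 1 \<or> fps_nth h 1 = -1"
proof -
  have "fps_nth (h oo h) 1 = fps_nth h 1 * fps_nth h 1"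
    using assms(2) by (simp add: fps_compose_nth)
  with assms(1) show ?thesis
    by (simp add: square_eq_1_iff)
qed

text \<open>Anti-averaging over the group \<open>{x, h}\<close> produces a coordinate in which \<open>h\<close> is a reflection.\<close>

lemma compose_involution_linearize:
  fixes h :: "'a::field_char_0 fps"
  assumes "h oo h = fps_X" "fps_nth h 0 = 0" "fps_nth h 1 = -1"
  obtains w where "fps_nth w 0 = 0" "fps_nth w 1 \<noteq> 0" "w oo h = - w"
proof
  let ?w = "fps_const (1/2) * (fps_X - h)"
  show "?w oo h = - ?w"
    using assms by (simp add: fps_compose_mult_distrib fps_compose_sub_distrib algebra_simps)
qed (use assms in auto)

section \<open>The logarithm of a power series\<close>

text \<open>The witness is \<open>ln(1 + x)\<close>, the compositional inverse of \<open>e\<^sup>x - 1\<close>, evaluated at \<open>F - 1\<close>.\<close>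

lemma fps_exp_of_surj:
  fixes F :: "'a::field_char_0 fps"
  assumes "fps_nth F 0 = 1"
  obtains L where "fps_nth L 0 = 0" "fps_exp_of L = F"
proof
  let ?E = "fps_exp (1::'a) - 1"
  let ?L = "fps_inv ?E oo (F - 1)"
  show "fps_nth ?L 0 = 0" by (simp add: fps_inv_def)
  have "?E oo ?L = (?E oo fps_inv ?E) oo (F - 1)"
    using assms by (simp add: fps_compose_assoc fps_inv_def)
  also have "\<dots> = F - 1"
    using assms by (simp add: fps_inv_right)
  finally show "fps_exp_of ?L = F"
    by (simp add: fps_exp_of_def fps_compose_sub_distrib)
qed

lemma fps_exp_of_inj:
  fixes a b :: "'a::field_char_0 fps"
  assumes "fps_nth a 0 = 0" "fps_nth b 0 = 0" "fps_exp_of a = fps_exp_of b"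
  shows "a = b"
proof (rule fps_compose_left_cancel)
  show "(fps_exp 1 - 1) oo a = (fps_exp 1 - 1) oo b"
    using assms by (simp add: fps_exp_of_def fps_compose_sub_distrib)
qed (use assms in auto)

lemma fps_exp_of_uminus:
  fixes a :: "'a::field_char_0 fps"
  assumes "fps_nth a 0 = 0"
  shows "fps_exp_of a * fps_exp_of (- a) = 1"
proof -
  have "fps_exp (1::'a) oo - fps_X = fps_exp (- 1)"
    using fps_compose_linear[of "fps_exp (1::'a)" "-1"]
    by (simp add: fps_eq_iff flip: fps_const_neg)
  then have "fps_exp_of (- a) = fps_exp (- 1) oo a"
    using assms fps_compose_assoc[of a "- fps_X" "fps_exp 1"]
    by (simp add: fps_exp_of_def fps_compose_uminus)
  then have "fps_exp_of a * fps_exp_of (- a) = (fps_exp 1 * fps_exp (- 1)) oo a"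
    using assms by (simp add: fps_exp_of_def fps_compose_mult_distrib)
  also have "\<dots> = 1"
    by (simp flip: fps_exp_add_mult)
  finally show ?thesis .
qed

section \<open>Riordan matrices acting on generating functions\<close>

lemma riordan_matrix_nth:
  fixes f g :: "'a::field fps"
  assumes "fps_nth g 0 \<noteq> 0"
  shows "riordan_matrix f g n k = fps_nth (f / g * (fps_X / g) ^ k) n"
proof -
  have "fps_nth (g ^ (k + 1)) 0 \<noteq> 0"
    using assms by (simp add: fps_nth_power_0)
  then have "fps_X ^ k * f / g ^ (k + 1) = f / g * (fps_X / g) ^ k"
    using assms by (simp add: fps_divide_unit fps_inverse_power fps_inverse_mult
        power_mult_distrib mult_ac)
  then show ?thesis by (simp add: riordan_matrix_def)
qed

text \<open>The weighted sum of the columns \<open>d h\<^sup>j\<close> is \<open>d \<sqdot> b(h)\<close>; only finitely many of them reach row \<open>n\<close>.\<close>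

lemma fps_mult_compose_nth:
  fixes d b h :: "'a::field fps"
  assumes "fps_nth h 0 = 0"
  shows "(\<Sum>j\<le>n. fps_nth (d * h ^ j) n * fps_nth b j) = fps_nth (d * (b oo h)) n"
proof -
  have ext: "fps_nth (b oo h) m = (\<Sum>j\<le>n. fps_nth b j * fps_nth (h ^ j) m)" if "m \<le> n" for m
    unfolding fps_compose_nth
    by (rule sum.mono_neutral_left) (use that startsby_zero_power_prefix[OF assms] in auto)
  have "fps_nth (d * (b oo h)) n
      = (\<Sum>i=0..n. \<Sum>j\<le>n. fps_nth d i * fps_nth (h ^ j) (n - i) * fps_nth b j)"
    by (simp add: fps_mult_nth ext sum_distrib_left mult_ac)
  also have "\<dots> = (\<Sum>j\<le>n. fps_nth (d * h ^ j) n * fps_nth b j)"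
    by (subst sum.swap) (simp add: fps_mult_nth sum_distrib_right)
  finally show ?thesis by simp
qed

text \<open>Column \<open>0\<close> of \<open>T\<^sup>2 = I\<close> is the first equation; it is a factor of column \<open>1\<close>, and removing it
  leaves the second.\<close>

lemma riordan_square_eq_I:
  fixes f g :: "'a::field fps"
  assumes g: "fps_nth g 0 \<noteq> 0"
    and sq: "lt_mult (riordan_matrix f g) (riordan_matrix f g) = riordan_matrix 1 1"
  defines "d \<equiv> f / g" and "h \<equiv> fps_X / g"
  shows "d * (d oo h) = 1" and "h oo h = fps_X"
proof -
  have h0: "fps_nth h 0 = 0" using g by (simp add: h_def fps_divide_unit)
  have col: "d * ((d * h ^ k) oo h) = fps_X ^ k" for k
  proof (rule fps_ext)
    fix n
    have "fps_nth (d * ((d * h ^ k) oo h)) n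
        = lt_mult (riordan_matrix f g) (riordan_matrix f g) n k"
      using fps_mult_compose_nth[OF h0, of d n "d * h ^ k"]
      by (simp add: lt_mult_def riordan_matrix_nth[OF g] flip: d_def h_def)
    then show "fps_nth (d * ((d * h ^ k) oo h)) n = fps_nth (fps_X ^ k) n"
      by (simp add: sq riordan_matrix_nth)
  qed
  show 1: "d * (d oo h) = 1" using col[of 0] by simp
  have "d * (d oo h) * (h oo h) = fps_X"
    using col[of 1] h0 by (simp add: fps_compose_mult_distrib mult.assoc)
  then show "h oo h = fps_X" by (simp add: 1)
qed

section \<open>Multipliers\<close>

text \<open>The equation forces \<open>d(0)\<^sup>2 = 1\<close>, so \<open>d\<close> has a logarithm up to sign, and injectivity of the
  exponential turns the multiplicative relation into antisymmetry under \<open>h\<close>.\<close>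

lemma multiplier_eq_exp:
  fixes d h :: "'a::field_char_0 fps"
  assumes "d * (d oo h) = 1" "fps_nth h 0 = 0"
  obtains s L where "s \<in> {1, -1}" "fps_nth L 0 = 0" "d = s * fps_exp_of L" "L oo h = - L"
proof -
  have "fps_nth (d * (d oo h)) 0 = 1" by (simp add: assms)
  then have "fps_nth d 0 = 1 \<or> fps_nth d 0 = - 1"
    by (simp add: square_eq_1_iff)
  then obtain s :: "'a fps" where s: "s \<in> {1, -1}" and sd: "fps_nth (s * d) 0 = 1"
    by (elim disjE) (auto simp: that[of 1] that[of "-1"])
  obtain L where L: "fps_nth L 0 = 0" "fps_exp_of L = s * d"
    using fps_exp_of_surj[OF sd] .
  have ss: "s * s = 1" and sh: "s oo h = s"
    using s by (auto simp: fps_compose_uminus)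
  have "fps_exp_of L * fps_exp_of (L oo h) = (s * d) * ((s * d) oo h)"
    using L assms(2) by (metis fps_exp_of_def fps_compose_assoc)
  also have "\<dots> = (s * s) * (d * (d oo h))"
    using assms(2) by (simp add: fps_compose_mult_distrib sh mult_ac)
  also have "\<dots> = fps_exp_of L * fps_exp_of (- L)"
    using ss assms(1) L(1) by (simp add: fps_exp_of_uminus)
  finally have "fps_exp_of (L oo h) = fps_exp_of (- L)"
    using L sd by auto
  then have "L oo h = - L"
    by (rule fps_exp_of_inj[rotated 2]) (use L assms(2) in auto)
  moreover have "d = s * fps_exp_of L"
    using ss by (simp add: L flip: mult.assoc)
  ultimately show ?thesis using that s L by blast
qed

section \<open>Riordan involutions\<close>

theorem proposition3:
  fixes M :: "nat \<Rightarrow> nat \<Rightarrow> 'a::field_char_0"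
  assumes "riordan_involution M"
    and "M \<noteq> riordan_matrix 1 1"
    and "M \<noteq> riordan_matrix (-1) 1"
  shows "\<exists>f g \<phi> u A s.
           M = riordan_matrix f g \<and> fps_nth f 0 \<noteq> 0 \<and> fps_nth g 0 \<noteq> 0 \<and>
           fps_nth \<phi> 0 \<noteq> 0 \<and> odd_fps u \<and> is_A_sequence \<phi> A \<and> s \<in> {1, -1} \<and>
           g = fps_X / fps_compose (fps_X / A) (- (fps_X / \<phi>)) \<and>
           f = s * fps_X / fps_compose (fps_X / A) (- (fps_X / \<phi>))
                 * fps_exp_of (fps_compose u (fps_X / \<phi>))"
proof -
  obtain f g where fg: "fps_nth f 0 \<noteq> 0" "fps_nth g 0 \<noteq> 0" and M: "M = riordan_matrix f g"
    using assms(1) by (auto simp: riordan_involution_def is_riordan_def)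
  define d h where "d = f / g" and "h = fps_X / g"
  have h0: "fps_nth h 0 = 0" and hg: "h * g = fps_X" and f: "f = d * g"
    using fg by (simp_all add: d_def h_def fps_divide_unit inverse_mult_eq_1 mult.assoc)
  have dd: "d * (d oo h) = 1" and hh: "h oo h = fps_X"
    using riordan_square_eq_I[of g f] fg(2) assms(1)
    by (simp_all add: riordan_involution_def M d_def h_def)

  have h1: "fps_nth h 1 = - 1"
  proof (rule ccontr)
    assume "fps_nth h 1 \<noteq> - 1"
    then have hX: "h = fps_X"
      using compose_involution_linear_coeff[OF hh h0] compose_involution_eq_X[OF hh h0] by blast
    then have "g = 1" using hg by simp
    moreover have "d = 1 \<or> d = - 1" using dd by (simp add: hX square_eq_1_iff)
    ultimately show False using assms(2,3) f M by auto
  qed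

  obtain w where w: "fps_nth w 0 = 0" "fps_nth w 1 \<noteq> 0" "w oo h = - w"
    using compose_involution_linearize[OF hh h0 h1] .
  define v where "v = fps_inv w"
  have v0: "fps_nth v 0 = 0" and v1: "fps_nth v 1 \<noteq> 0"
    using w by (simp_all add: v_def fps_inv_def)
  have vw: "v oo w = fps_X" and wv: "w oo v = fps_X"
    using w by (simp_all add: v_def fps_inv fps_inv_right)
  \<comment> \<open>Since \<open>- w = w(h)\<close>, applying \<open>v\<close> recovers \<open>h\<close>.\<close>
  have h_eq: "h = v oo - w"
    using w h0 v0 by (metis fps_compose_assoc vw fps_X_fps_compose_startby0)
  obtain \<phi> where \<phi>: "fps_nth \<phi> 0 \<noteq> 0" "fps_X / \<phi> = w"
    using order_one_fps_eq_X_divide w by blast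
  obtain A where A: "fps_nth A 0 \<noteq> 0" "fps_X / A = v"
    using order_one_fps_eq_X_divide v0 v1 by blast

  obtain s L where s: "s \<in> {1, -1}" and L: "d = s * fps_exp_of L" "L oo h = - L"
    using multiplier_eq_exp[OF dd h0] by blast
  define u where "u = L oo v"
  have uw: "u oo w = L"
    using w v0 by (simp add: u_def vw flip: fps_compose_assoc)
  \<comment> \<open>In the coordinate \<open>w\<close> the involution \<open>h\<close> is the reflection, so antisymmetry is oddness.\<close>
  have "h oo v = v oo - fps_X"
    using w(1) v0 by (simp add: h_eq wv fps_compose_uminus flip: fps_compose_assoc)
  then have "u oo - fps_X = (L oo h) oo v"
    using v0 h0 by (simp add: u_def flip: fps_compose_assoc)
  then have "odd_fps u"
    by (simp add: odd_fps_iff_compose_uminus_X L fps_compose_uminus u_def)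

  have "h \<noteq> 0" using h1 by auto
  then have g_eq: "g = fps_X / h" and sg: "s * fps_X / h = s * g"
    by (simp_all flip: hg add: mult.left_commute[of s])
  show ?thesis
  proof (intro exI conjI)
    show "M = riordan_matrix f g" by (fact M)
    show "is_A_sequence \<phi> A"
      using A by (simp add: is_A_sequence_def \<phi> vw wv)
    show "f = s * fps_X / fps_compose (fps_X / A) (- (fps_X / \<phi>))
        * fps_exp_of (fps_compose u (fps_X / \<phi>))"
      unfolding A \<phi> uw h_eq[symmetric] sg f L(1) by (simp add: mult_ac)
  qed (use fg \<phi> A s g_eq h_eq \<open>odd_fps u\<close> in simp_all)
qed

end
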